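(* There exists a pair $(X,Y)$ of finite-alphabet random variables such that $$G(X^2;Y^2)<2\,G(X;Y),$$ where $(X^2,Y^2)=((X_1,X_2),(Y_1,Y_2))$ with $(X_1,Y_1),(X_2,Y_2)$ i.i.d. copies of $(X,Y)$. Explicitly, this strict inequality holds for the pair $(X,Y)$ with binary alphabets and joint pmf $$p_{X,Y}=\begin{bmatrix}1/3&1/3\\1/3&0\end{bmatrix}.$$
   Context: All random variables are discrete; $H$ denotes Shannon entropy. For discrete random variables $A,B$ with finite alphabets, $G(A;B)=\min_{W:\,A\to W\to B}H(W)$, the minimum being over all discrete $W$ jointly distributed with $(A,B)$ (whose joint pmf is fixed) such that $A$ and $B$ are conditionally independent given $W$. *)

theory Defs
  imports "HOL-Probability.Probability"
begin

text \<open>A discrete random variable enters only through its law. The library constant for entropy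
  is a real-valued Bochner integral, which returns \<open>0\<close> when the series diverges, so the entropy
  of a countable distribution is taken in \<^typ>\<open>ennreal\<close>. Since \<open>log 2 0 = 0\<close>, points
  of probability zero contribute nothing.\<close>

definition shannon_entropy :: "'w pmf \<Rightarrow> ennreal" where
  "shannon_entropy p = (\<integral>\<^sup>+ w. ennreal (- (pmf p w * log 2 (pmf p w))) \<partial>count_space UNIV)"

text \<open>Laws of triples \<open>(W, A, B)\<close> in which \<open>(A, B)\<close> has the law \<open>p\<close> and, for each value \<open>w\<close> that
  \<open>W\<close> takes with positive probability, the conditional law of \<open>(A, B)\<close> given \<open>W = w\<close> is the
  product of its marginals (that is, \<open>A \<rightarrow> W \<rightarrow> B\<close>).\<close>

definition markov_couplings :: "('a \<times> 'b) pmf \<Rightarrow> ('w \<times> 'a \<times> 'b) pmf set" where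
  "markov_couplings p = {q. map_pmf snd q = p \<and>
     (\<forall>w \<in> set_pmf (map_pmf fst q).
        let r = map_pmf snd (cond_pmf q ({w} \<times> UNIV))
        in r = pair_pmf (map_pmf fst r) (map_pmf snd r))}"

text \<open>\<open>W\<close> ranges over all discrete random variables. A definition cannot quantify over the alphabet
  type, so \<open>W\<close> takes values in \<^typ>\<open>nat\<close>; by \<open>ex_nat_markov_coupling\<close> below this
  loses nothing. \<open>LEAST\<close> is a genuine minimum: it is meaningful only if it is attained.\<close>

definition common_entropy :: "('a \<times> 'b) pmf \<Rightarrow> ennreal" where
  "common_entropy p =
     (LEAST h. \<exists>q :: (nat \<times> 'a \<times> 'b) pmf.
        q \<in> markov_couplings p \<and> h = shannon_entropy (map_pmf fst q))"

text \<open>The law of \<open>((X\<^sub>1, X\<^sub>2), (Y\<^sub>1, Y\<^sub>2))\<close> for \<open>(X\<^sub>1, Y\<^sub>1)\<close>, \<open>(X\<^sub>2, Y\<^sub>2)\<close> i.i.d. with law \<open>p\<close>.\<close>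

definition iid_square :: "('a \<times> 'b) pmf \<Rightarrow> (('a \<times> 'a) \<times> ('b \<times> 'b)) pmf" where
  "iid_square p = map_pmf (\<lambda>((x\<^sub>1, y\<^sub>1), (x\<^sub>2, y\<^sub>2)). ((x\<^sub>1, x\<^sub>2), (y\<^sub>1, y\<^sub>2))) (pair_pmf p p)"

lemma shannon_entropy_map_inj:
  assumes "inj_on f (set_pmf p)"
  shows "shannon_entropy (map_pmf f p) = shannon_entropy p"
proof -
  let ?g = "\<lambda>t::real. ennreal (- (t * log 2 t))"
  have "shannon_entropy (map_pmf f p)
      = (\<integral>\<^sup>+ v. ?g (pmf (map_pmf f p) v) \<partial>count_space (f ` set_pmf p))"
    unfolding shannon_entropy_def
    by (rule nn_integral_count_space_eq) (auto simp: pmf_map_outside)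
  also have "\<dots> = (\<integral>\<^sup>+ w. ?g (pmf (map_pmf f p) (f w)) \<partial>count_space (set_pmf p))"
    by (rule nn_integral_bij_count_space[symmetric]) (rule inj_on_imp_bij_betw[OF assms])
  also have "\<dots> = (\<integral>\<^sup>+ w. ?g (pmf p w) \<partial>count_space (set_pmf p))"
    by (rule nn_integral_cong) (simp add: pmf_map_inj[OF assms])
  also have "\<dots> = shannon_entropy p"
    unfolding shannon_entropy_def
    by (rule nn_integral_count_space_eq) (auto simp: set_pmf_iff)
  finally show ?thesis .
qed

lemma ex_nat_markov_coupling:
  fixes q :: "('w \<times> 'a \<times> 'b) pmf"
  assumes q: "q \<in> markov_couplings p"
  shows "\<exists>q' :: (nat \<times> 'a \<times> 'b) pmf. q' \<in> markov_couplings p \<and>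
           shannon_entropy (map_pmf fst q') = shannon_entropy (map_pmf fst q)"
proof -
  define S where "S = set_pmf (map_pmf fst q)"
  obtain f :: "'w \<Rightarrow> nat" where f: "inj_on f S"
    using countableE[of S] by (auto simp: S_def)
  define q' where "q' = map_pmf (map_prod f id) q"
  have marg: "map_pmf fst q' = map_pmf f (map_pmf fst q)"
    by (simp add: q'_def map_pmf_comp)
  have snd: "map_pmf snd q' = p"
    using q by (simp add: q'_def map_pmf_comp markov_couplings_def)
  have cond: "map_pmf snd (cond_pmf q' ({f w} \<times> UNIV)) = map_pmf snd (cond_pmf q ({w} \<times> UNIV))"
    if w: "w \<in> S" for w
  proof -
    let ?V = "map_prod f id -` ({f w} \<times> (UNIV :: ('a \<times> 'b) set))"
    obtain ab where wab: "(w, ab) \<in> set_pmf q"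
      using w by (auto simp: S_def)
    have eq: "v = w" if "(v, z) \<in> set_pmf q" "f v = f w" for v z
      using that f w by (force simp: S_def dest: inj_onD)
    have ne: "set_pmf q \<inter> ?V \<noteq> {}" "set_pmf q \<inter> ({w} \<times> UNIV) \<noteq> {}"
      using wab by auto
    have int: "set_pmf q \<inter> ?V = set_pmf q \<inter> ({w} \<times> UNIV)"
      using eq by auto
    have meas: "measure q ?V = measure q ({w} \<times> UNIV)"
      using measure_Int_set_pmf[of q ?V] measure_Int_set_pmf[of q "{w} \<times> UNIV"] int
      by (simp add: Int_commute)
    have "cond_pmf q ?V = cond_pmf q ({w} \<times> UNIV)"
    proof (rule pmf_eqI)
      fix x
      have "x \<in> ?V \<longleftrightarrow> x \<in> {w} \<times> UNIV" if "x \<in> set_pmf q"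
        using int that by blast
      then show "pmf (cond_pmf q ?V) x = pmf (cond_pmf q ({w} \<times> UNIV)) x"
        unfolding pmf_cond[OF ne(1)] pmf_cond[OF ne(2)] meas
        by (cases "x \<in> set_pmf q") (simp_all only: set_pmf_iff simp_thms if_cancel div_0)
    qed
    moreover have "cond_pmf q' ({f w} \<times> UNIV) = map_pmf (map_prod f id) (cond_pmf q ?V)"
      unfolding q'_def by (rule cond_map_pmf[OF ne(1)])
    ultimately show ?thesis
      by (simp add: map_pmf_comp)
  qed
  have "q' \<in> markov_couplings p"
    unfolding markov_couplings_def mem_Collect_eq Let_def
  proof (intro conjI ballI snd)
    fix v assume "v \<in> set_pmf (map_pmf fst q')"
    then obtain w where w: "w \<in> S" "v = f w"
      unfolding marg set_map_pmf S_def by blast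
    let ?r = "map_pmf snd (cond_pmf q ({w} \<times> UNIV))"
    have "?r = pair_pmf (map_pmf fst ?r) (map_pmf snd ?r)"
      using q w(1) unfolding markov_couplings_def mem_Collect_eq Let_def S_def by blast
    then show "map_pmf snd (cond_pmf q' ({v} \<times> UNIV)) =
        pair_pmf (map_pmf fst (map_pmf snd (cond_pmf q' ({v} \<times> UNIV))))
          (map_pmf snd (map_pmf snd (cond_pmf q' ({v} \<times> UNIV))))"
      unfolding w(2) cond[OF w(1)] .
  qed
  moreover have "shannon_entropy (map_pmf fst q') = shannon_entropy (map_pmf fst q)"
    unfolding marg by (rule shannon_entropy_map_inj) (use f in \<open>simp add: S_def\<close>)
  ultimately show ?thesis by blast
qed

end

theory Submission
  imports Defs
begin

text \<open>Both minima are computed exactly. Each value of \<open>W\<close> sees a combinatorial rectangle inside the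
  support of \<open>(X, Y)\<close>; fooling sets and a bound on the size of a rectangle then limit the total
  mass of any \<open>k\<close> values of \<open>W\<close>. For the single pair the law of \<open>W\<close> is majorized by
  \<open>(2/3, 1/3)\<close>, for the square by \<open>(4/9, 3/9, 1/9, 1/9)\<close>. By Schur concavity these vectors bound
  \<open>H(W)\<close> below, and both are attained by taking \<open>W\<close> to be a function of \<open>(X, Y)\<close>. The inequality
  reduces to \<open>log 2 3 > 4/3\<close>, that is, \<open>27 > 16\<close>.\<close>

section \<open>Entropy lower bounds by majorization\<close>

text \<open>The total mass is 1, so at most \<open>1 / pmf m v\<close> atoms are as heavy as
  \<open>v\<close>: only finitely many candidates compete, even in an infinite
  \<open>S\<close>.\<close>

lemma pmf_attains_sup:
  fixes m :: "'w pmf"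
  assumes v: "v \<in> S" "0 < pmf m v"
  shows "\<exists>w\<in>S. 0 < pmf m w \<and> (\<forall>u\<in>S. pmf m u \<le> pmf m w)"
proof -
  let ?B = "{u \<in> S. pmf m v \<le> pmf m u}"
  have card_le: "card F \<le> nat \<lfloor>1 / pmf m v\<rfloor>" if F: "F \<subseteq> ?B" "finite F" for F
  proof -
    have "real (card F) * pmf m v \<le> (\<Sum>u\<in>F. pmf m u)"
      using F sum_bounded_below[of F "pmf m v" "pmf m"] by auto
    also have "\<dots> = measure m F"
      using F(2) by (simp add: measure_measure_pmf_finite)
    also have "\<dots> \<le> 1"
      by simp
    finally have "real (card F) \<le> 1 / pmf m v"
      using v(2) by (simp add: field_simps)
    then show ?thesis
      by (simp add: le_nat_floor)
  qed
  have fin: "finite ?B"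
    using finite_if_finite_subsets_card_bdd[of ?B] card_le by metis
  have ne: "?B \<noteq> {}"
    using v by auto
  have "Max (pmf m ` ?B) \<in> pmf m ` ?B"
    using fin ne by (intro Max_in) auto
  then obtain w where w: "Max (pmf m ` ?B) = pmf m w" "w \<in> ?B"
    by (rule imageE)
  have "pmf m u \<le> pmf m w" if "u \<in> S" for u
  proof (cases "u \<in> ?B")
    case True
    then show ?thesis
      using Max_ge[of "pmf m ` ?B" "pmf m u"] fin w(1) by simp
  next
    case False
    then show ?thesis
      using w(2) that by auto
  qed
  moreover have "w \<in> S" "0 < pmf m w"
    using w(2) v(2) by auto
  ultimately show ?thesis
    by blast
qed

text \<open>Summation by parts: with D_k the partial sums of \<open>d\<close>, the right side minus
  the left is the sum over k < n of -D_k (L_{k+1} - L_k), whose terms are all nonnegative.\<close>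

lemma sum_mult_mono_le:
  fixes d L :: "nat \<Rightarrow> real"
  assumes "\<And>k. k < n \<Longrightarrow> (\<Sum>i\<le>k. d i) \<le> 0"
    and "\<And>k. k < n \<Longrightarrow> L k \<le> L (Suc k)"
  shows "(\<Sum>i\<le>n. d i) * L n \<le> (\<Sum>i\<le>n. d i * L i)"
  using assms
proof (induction n)
  case (Suc n)
  have "(\<Sum>i\<le>n. d i) * L (Suc n) \<le> (\<Sum>i\<le>n. d i) * L n"
    using Suc.prems(1)[of n] Suc.prems(2)[of n] by (intro mult_left_mono_neg) auto
  also have "\<dots> \<le> (\<Sum>i\<le>n. d i * L i)"
    using Suc by simp
  finally show ?case
    by (simp add: algebra_simps)
qed simp

text \<open>Follows from ln x \<le> x - 1 at x = m_i / t_i. The total of \<open>m\<close> may fall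
  short of that of \<open>t\<close>, because the heaviest atoms of a law need not exhaust
  it.\<close>

lemma gibbs_inequality:
  fixes t m :: "'i \<Rightarrow> real"
  assumes "\<And>i. i \<in> I \<Longrightarrow> 0 < t i" "\<And>i. i \<in> I \<Longrightarrow> 0 < m i"
    and "sum m I \<le> sum t I"
  shows "(\<Sum>i\<in>I. - (t i * log 2 (t i))) \<le> (\<Sum>i\<in>I. t i * (- log 2 (m i)))"
proof -
  have "t i * log 2 (m i) - t i * log 2 (t i) \<le> (m i - t i) / ln 2" if i: "i \<in> I" for i
  proof -
    have "t i * ln (m i / t i) \<le> t i * (m i / t i - 1)"
      using assms(1,2)[OF i] ln_le_minus_one[of "m i / t i"] by (intro mult_left_mono) auto
    then have "t i * (ln (m i) - ln (t i)) \<le> m i - t i"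
      using assms(1,2)[OF i] by (simp add: ln_div right_diff_distrib)
    then have "t i * (ln (m i) - ln (t i)) / ln 2 \<le> (m i - t i) / ln 2"
      by (intro divide_right_mono) auto
    then show ?thesis
      by (simp add: log_def right_diff_distrib diff_divide_distrib)
  qed
  then have "(\<Sum>i\<in>I. t i * log 2 (m i) - t i * log 2 (t i)) \<le> (\<Sum>i\<in>I. (m i - t i) / ln 2)"
    by (rule sum_mono)
  also have "\<dots> = (sum m I - sum t I) / ln 2"
    by (simp add: sum_divide_distrib[symmetric] sum_subtractf)
  also have "\<dots> \<le> 0"
    using assms(3) by (simp add: divide_nonpos_pos)
  finally show ?thesis
    by (simp add: sum_subtractf sum_negf)
qed

text \<open>Greedy choice: fewer than \<open>n\<close> atoms never carry the whole mass, so positive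
  mass remains, and \<open>pmf_attains_sup\<close> picks a heaviest atom outside those already
  listed.\<close>

lemma decreasing_enumeration:
  fixes m :: "'w pmf"
  assumes small: "\<And>F. finite F \<Longrightarrow> card F < n \<Longrightarrow> measure m F < 1"
  shows "\<exists>e :: nat \<Rightarrow> 'w. inj_on e {..<n} \<and>
    (\<forall>i<n. 0 < pmf m (e i) \<and> (\<forall>v. v \<notin> e ` {..<i} \<longrightarrow> pmf m v \<le> pmf m (e i)))"
  using assms
proof (induction n)
  case (Suc n)
  have small: "measure m F < 1" if "finite F" "card F < n" for F
    using Suc.prems[of F] that by simp
  have "\<exists>e :: nat \<Rightarrow> 'w. inj_on e {..<n} \<and>
      (\<forall>i<n. 0 < pmf m (e i) \<and> (\<forall>v. v \<notin> e ` {..<i} \<longrightarrow> pmf m v \<le> pmf m (e i)))"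
    by (rule Suc.IH) (rule small)
  then obtain e :: "nat \<Rightarrow> 'w" where e: "inj_on e {..<n}"
    "\<forall>i<n. 0 < pmf m (e i) \<and> (\<forall>v. v \<notin> e ` {..<i} \<longrightarrow> pmf m v \<le> pmf m (e i))"
    by (elim exE conjE)
  let ?F = "e ` {..<n}"
  have "measure m ?F < 1"
    using Suc.prems[of ?F] card_image[OF e(1)] by simp
  moreover have "measure m ?F = 1" if "set_pmf m \<subseteq> ?F"
    using that measure_Int_set_pmf[of m ?F] measure_pmf.prob_eq_1[of "set_pmf m" m]
    by (simp add: Int_absorb1 AE_measure_pmf)
  ultimately have "\<not> set_pmf m \<subseteq> ?F"
    by linarith
  then obtain v where "v \<notin> ?F" "v \<in> set_pmf m"
    unfolding subset_iff not_all not_imp by (elim exE conjE)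
  then have v: "v \<in> - ?F" "0 < pmf m v"
    by (simp_all add: pmf_positive)
  from pmf_attains_sup[OF v] obtain w where
    "w \<in> - ?F" and w: "0 < pmf m w" "\<forall>u\<in>- ?F. pmf m u \<le> pmf m w"
    by (elim bexE conjE)
  then have w_notin: "w \<notin> ?F"
    by simp
  let ?e = "e(n := w)"
  have img: "?e ` {..<i} = e ` {..<i}" if "i \<le> n" for i
    using that by (intro image_cong) auto
  have "inj_on ?e {..<Suc n}"
    unfolding lessThan_Suc using e(1) w_notin by (auto simp: inj_on_def)
  moreover have "0 < pmf m (?e i) \<and> (\<forall>v. v \<notin> ?e ` {..<i} \<longrightarrow> pmf m v \<le> pmf m (?e i))"
    if "i < Suc n" for i
  proof (cases "i = n")
    case True
    then show ?thesis
      using w img[of n] by simp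
  next
    case False
    then show ?thesis
      using e(2) img[of i] that by simp
  qed
  ultimately show ?case
    by (intro exI[of _ ?e] conjI allI impI) blast+
qed simp

text \<open>Schur concavity of entropy: \<open>m\<close> is majorized by \<open>t\<close>. If \<open>m\<^sub>0 \<ge> m\<^sub>1 \<ge> \<dots>\<close> are the masses of
  the \<open>n\<close> heaviest atoms, then bounding the surprise of every lighter atom below by
  \<open>- log 2 m\<^sub>n\<^sub>-\<^sub>1\<close> and summing by parts gives \<open>H(m) \<ge> \<Sum>i<n. t\<^sub>i (- log 2 m\<^sub>i)\<close>.\<close>

lemma shannon_entropy_ge_majorized:
  fixes m :: "'w pmf" and t :: "nat \<Rightarrow> real"
  assumes n: "0 < n"
    and t_pos: "\<And>i. i < n \<Longrightarrow> 0 < t i"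
    and t_sum: "(\<Sum>i<n. t i) = 1"
    and maj: "\<And>F. finite F \<Longrightarrow> card F < n \<Longrightarrow> measure m F \<le> (\<Sum>i<card F. t i)"
  shows "ennreal (\<Sum>i<n. - (t i * log 2 (t i))) \<le> shannon_entropy m"
proof -
  obtain N where N: "n = Suc N"
    using n gr0_implies_Suc by blast
  \<comment> \<open>Omitting at least one positive \<open>t i\<close> brings the majorant strictly
    below 1.\<close>
  have "measure m F < 1" if F: "finite F" "card F < n" for F
  proof -
    have "(\<Sum>i<card F. t i) < (\<Sum>i<n. t i)"
      using F t_pos by (intro sum_strict_mono2[where b = "card F"]) (auto intro: less_imp_le)
    then show ?thesis
      using maj[OF F] t_sum by simp
  qed
  then obtain e :: "nat \<Rightarrow> 'w" where inj: "inj_on e {..<n}"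
    and pos: "\<And>i. i < n \<Longrightarrow> 0 < pmf m (e i)"
    and max: "\<And>i v. i < n \<Longrightarrow> v \<notin> e ` {..<i} \<Longrightarrow> pmf m v \<le> pmf m (e i)"
    using decreasing_enumeration[of n m] by blast
  define L where "L w = - log 2 (pmf m w)" for w
  have L_nonneg: "0 \<le> L (e i)" if "i < n" for i
    using pos[OF that] pmf_le_1[of m "e i"] by (simp add: L_def)
  have prefix: "(\<Sum>i\<le>k. pmf m (e i)) = measure m (e ` {..k})" if "k < n" for k
  proof -
    have "inj_on e {..k}"
      using that by (auto intro: inj_on_subset[OF inj])
    then show ?thesis
      by (simp add: measure_measure_pmf_finite sum.reindex)
  qed
  \<comment> \<open>The surprise cut off at its value on the last listed atom. It takes finitely
    many values, so it is integrable even when the entropy of \<open>m\<close> is infinite.\<close>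
  define s where "s w = (if w \<in> e ` {..<N} then L w else L (e N))" for w
  have s_e: "s (e i) = L (e i)" if "i < n" for i
    using that by (cases "i = N") (auto simp: s_def N)
  have s_nonneg: "0 \<le> s w" for w
    using L_nonneg by (auto simp: s_def N)
  have s_le: "pmf m w * s w \<le> - (pmf m w * log 2 (pmf m w))" for w
  proof (cases "w \<in> e ` {..<N} \<or> pmf m w = 0")
    case True
    then show ?thesis
      by (auto simp: s_def L_def)
  next
    case False
    then have "log 2 (pmf m w) \<le> log 2 (pmf m (e N))"
      using max[of N w] pos[of N] by (auto simp: N pmf_positive_iff less_le)
    then have "pmf m w * log 2 (pmf m w) \<le> pmf m w * log 2 (pmf m (e N))"
      by (intro mult_left_mono) auto
    then show ?thesis
      using False by (simp add: s_def L_def)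
  qed
  \<comment> \<open>The term \<open>i = N\<close> vanishes, so the sum may run up to
    \<open>N\<close> although \<open>s\<close> singles out only the indices below
    \<open>N\<close>.\<close>
  have decomp: "s w = L (e N) + (\<Sum>i\<le>N. (L (e i) - L (e N)) * indicator {e i} w)" for w
  proof (cases "w \<in> e ` {..N}")
    case True
    then obtain j where j: "j \<le> N" "w = e j"
      by auto
    have "(\<Sum>i\<le>N. (L (e i) - L (e N)) * indicator {e i} w)
        = (\<Sum>i\<le>N. if i = j then L (e i) - L (e N) else 0)"
      using j inj by (intro sum.cong) (auto simp: indicator_def N inj_on_def)
    then show ?thesis
      using j s_e[of j] by (simp add: N)
  next
    case False
    then have "(\<Sum>i\<le>N. (L (e i) - L (e N)) * indicator {e i} w) = 0"
      by (intro sum.neutral) (auto simp: indicator_def)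
    moreover have "s w = L (e N)"
      using False by (auto simp: s_def)
    ultimately show ?thesis
      by simp
  qed
  have int_ind: "integrable m (\<lambda>w. (L (e i) - L (e N)) * indicator {e i} w)" for i
    by (intro integrable_mult_right measure_pmf.integrable_const_bound[where B = 1])
      (auto simp: indicator_def)
  have int_sum: "integrable m (\<lambda>w. \<Sum>i\<le>N. (L (e i) - L (e N)) * indicator {e i} w)"
    by (rule Bochner_Integration.integrable_sum) (rule int_ind)
  have "measure_pmf.expectation m s
      = L (e N) + (\<integral>w. (\<Sum>i\<le>N. (L (e i) - L (e N)) * indicator {e i} w) \<partial>m)"
    unfolding decomp by (subst Bochner_Integration.integral_add[OF _ int_sum]) auto
  also have "(\<integral>w. (\<Sum>i\<le>N. (L (e i) - L (e N)) * indicator {e i} w) \<partial>m)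
      = (\<Sum>i\<le>N. (L (e i) - L (e N)) * pmf m (e i))"
    by (subst Bochner_Integration.integral_sum[OF int_ind]) (simp add: measure_pmf_single)
  finally have exp_s: "measure_pmf.expectation m s
      = L (e N) + (\<Sum>i\<le>N. (L (e i) - L (e N)) * pmf m (e i))" .
  have int_s: "integrable m s"
    unfolding decomp by (rule Bochner_Integration.integrable_add[OF _ int_sum]) simp
  define d where "d i = pmf m (e i) - t i" for i
  \<comment> \<open>\<open>maj\<close> covers fewer than \<open>n = Suc N\<close> atoms, which
    excludes \<open>k = N\<close>; the full sum enters as the boundary term instead.\<close>
  have d_le: "(\<Sum>i\<le>k. d i) \<le> 0" if "k < N" for k
  proof -
    have "card (e ` {..k}) = Suc k"
      using that by (subst card_image) (auto intro: inj_on_subset[OF inj] simp: N)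
    then show ?thesis
      using maj[of "e ` {..k}"] prefix[of k] that
      by (simp add: d_def sum_subtractf N lessThan_Suc_atMost)
  qed
  have L_mono: "L (e k) \<le> L (e (Suc k))" if "k < N" for k
  proof -
    have "e (Suc k) \<notin> e ` {..<k}"
      using that inj_onD[OF inj, of "Suc k"] by (fastforce simp: N)
    then show ?thesis
      using max[of k "e (Suc k)"] pos[of k] pos[of "Suc k"] that by (simp add: L_def N)
  qed
  have t_sum': "(\<Sum>i\<le>N. t i) = 1"
    using t_sum by (simp add: N lessThan_Suc_atMost)
  have m_sum: "(\<Sum>i\<le>N. pmf m (e i)) \<le> 1"
    using prefix[of N] by (simp add: N)
  have "(\<Sum>i\<le>N. - (t i * log 2 (t i))) \<le> (\<Sum>i\<le>N. t i * L (e i))"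
    unfolding L_def using t_pos pos m_sum t_sum'
    by (intro gibbs_inequality) (auto simp: N)
  \<comment> \<open>With M the mass of the listed atoms, the boundary term is (M - 1) times
    \<open>L (e N)\<close>. Moved across, it accounts for the remaining mass 1 - M at the cut-off
    surprise.\<close>
  also have "\<dots> \<le> L (e N) + (\<Sum>i\<le>N. (L (e i) - L (e N)) * pmf m (e i))"
    using sum_mult_mono_le[of N d "\<lambda>i. L (e i)", OF d_le L_mono] t_sum'
    by (simp add: d_def sum_subtractf algebra_simps sum_distrib_left)
  also have "\<dots> = measure_pmf.expectation m s"
    by (simp add: exp_s)
  finally have "ennreal (\<Sum>i\<le>N. - (t i * log 2 (t i))) \<le> ennreal (measure_pmf.expectation m s)"
    by (rule ennreal_leI)
  also have "\<dots> = (\<integral>\<^sup>+ w. ennreal (s w) \<partial>measure_pmf m)"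
    using int_s s_nonneg by (intro nn_integral_eq_integral[symmetric]) auto
  also have "\<dots> = (\<integral>\<^sup>+ w. ennreal (pmf m w) * ennreal (s w) \<partial>count_space UNIV)"
    by (rule nn_integral_measure_pmf)
  also have "\<dots> \<le> shannon_entropy m"
    unfolding shannon_entropy_def
    by (intro nn_integral_mono) (simp add: ennreal_mult'[symmetric] s_nonneg ennreal_leI s_le)
  finally show ?thesis
    by (simp add: N lessThan_Suc_atMost)
qed

lemma shannon_entropy_finite:
  fixes m :: "nat pmf"
  assumes "set_pmf m \<subseteq> {..<n}"
  shows "shannon_entropy m = ennreal (\<Sum>i<n. - (pmf m i * log 2 (pmf m i)))"
proof -
  have nonneg: "0 \<le> - (pmf m i * log 2 (pmf m i))" for i
    using pmf_le_1[of m i] pmf_nonneg[of m i]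
    by (cases "pmf m i = 0") (auto intro!: mult_nonneg_nonpos simp: less_le)
  have "shannon_entropy m = (\<Sum>i<n. ennreal (- (pmf m i * log 2 (pmf m i))))"
    unfolding shannon_entropy_def
  proof (intro nn_integral_count_space')
    fix w assume "w \<notin> {..<n}"
    then have "pmf m w = 0"
      using assms by (auto simp: set_pmf_iff)
    then show "ennreal (- (pmf m w * log 2 (pmf m w))) = 0"
      by simp
  qed auto
  also have "\<dots> = ennreal (\<Sum>i<n. - (pmf m i * log 2 (pmf m i)))"
    using nonneg by (intro sum_ennreal) blast
  finally show ?thesis .
qed

section \<open>Markov couplings and bounds on the law of W\<close>

lemma pair_pmf_if_fst_const:
  assumes "\<And>z. z \<in> set_pmf r \<Longrightarrow> fst z = a"
  shows "r = pair_pmf (map_pmf fst r) (map_pmf snd r)"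
proof -
  have "map_pmf fst r = map_pmf (\<lambda>_. a) r"
    using assms by (intro map_pmf_cong) auto
  then have "pair_pmf (map_pmf fst r) (map_pmf snd r) = map_pmf (\<lambda>z. (a, snd z)) r"
    by (simp add: map_pmf_const pair_return_pmf1 map_pmf_comp)
  also have "\<dots> = map_pmf (\<lambda>z. z) r"
    using assms by (intro map_pmf_cong) (auto simp: prod_eq_iff)
  finally show ?thesis
    by simp
qed

lemma pair_pmf_if_snd_const:
  assumes "\<And>z. z \<in> set_pmf r \<Longrightarrow> snd z = b"
  shows "r = pair_pmf (map_pmf fst r) (map_pmf snd r)"
proof -
  have "map_pmf snd r = map_pmf (\<lambda>_. b) r"
    using assms by (intro map_pmf_cong) auto
  then have "pair_pmf (map_pmf fst r) (map_pmf snd r) = map_pmf (\<lambda>z. (fst z, b)) r"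
    by (simp add: map_pmf_const pair_return_pmf2 map_pmf_comp)
  also have "\<dots> = map_pmf (\<lambda>z. z) r"
    using assms by (intro map_pmf_cong) (auto simp: prod_eq_iff)
  finally show ?thesis
    by simp
qed

lemma set_pmf_cond_fst:
  assumes "w \<in> set_pmf (map_pmf fst q)"
  shows "set_pmf (map_pmf snd (cond_pmf q ({w} \<times> UNIV))) = {z. (w, z) \<in> set_pmf q}"
proof -
  have "set_pmf q \<inter> ({w} \<times> UNIV) \<noteq> {}"
    using assms by auto
  then show ?thesis
    by (force simp: set_cond_pmf)
qed

text \<open>Each fibre of \<open>g\<close> lies in one row or column of the support, so one
  coordinate is constant given W, and a constant is independent of everything.\<close>

lemma deterministic_markov_coupling:
  assumes "\<And>w. (\<exists>a. \<forall>z\<in>set_pmf p. g z = w \<longrightarrow> fst z = a) \<or>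
    (\<exists>b. \<forall>z\<in>set_pmf p. g z = w \<longrightarrow> snd z = b)"
  shows "map_pmf (\<lambda>z. (g z, z)) p \<in> markov_couplings p"
  unfolding markov_couplings_def mem_Collect_eq Let_def
proof (intro conjI ballI)
  let ?q = "map_pmf (\<lambda>z. (g z, z)) p"
  show "map_pmf snd ?q = p"
    by (simp add: map_pmf_comp)
  fix w assume "w \<in> set_pmf (map_pmf fst ?q)"
  then have r: "set_pmf (map_pmf snd (cond_pmf ?q ({w} \<times> UNIV))) = {z. (w, z) \<in> set_pmf ?q}"
    by (rule set_pmf_cond_fst)
  let ?r = "map_pmf snd (cond_pmf ?q ({w} \<times> UNIV))"
  from assms[of w] show "?r = pair_pmf (map_pmf fst ?r) (map_pmf snd ?r)"
  proof (elim disjE exE)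
    fix a assume "\<forall>z\<in>set_pmf p. g z = w \<longrightarrow> fst z = a"
    then show ?thesis
      by (intro pair_pmf_if_fst_const[of _ a]) (auto simp only: r, auto)
  next
    fix b assume "\<forall>z\<in>set_pmf p. g z = w \<longrightarrow> snd z = b"
    then show ?thesis
      by (intro pair_pmf_if_snd_const[of _ b]) (auto simp only: r, auto)
  qed
qed

text \<open>The conditional law given W = \<open>w\<close> is a product, and the support of a
  product law is the product of the supports of its marginals.\<close>

lemma markov_coupling_rectangle:
  assumes q: "q \<in> markov_couplings p"
    and "(w, a, b) \<in> set_pmf q" "(w, a', b') \<in> set_pmf q"
  shows "(w, a, b') \<in> set_pmf q"
proof -
  let ?r = "map_pmf snd (cond_pmf q ({w} \<times> UNIV))"
  have w: "w \<in> set_pmf (map_pmf fst q)"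
    using assms(2) by force
  have "?r = pair_pmf (map_pmf fst ?r) (map_pmf snd ?r)"
    using q w unfolding markov_couplings_def mem_Collect_eq Let_def by blast
  then have "set_pmf ?r = fst ` set_pmf ?r \<times> snd ` set_pmf ?r"
    by (metis set_map_pmf set_pair_pmf)
  then have "{z. (w, z) \<in> set_pmf q} = fst ` {z. (w, z) \<in> set_pmf q} \<times> snd ` {z. (w, z) \<in> set_pmf q}"
    unfolding set_pmf_cond_fst[OF w] .
  then show ?thesis
    using assms(2,3) by force
qed

lemma markov_coupling_support:
  assumes "q \<in> markov_couplings p" "(w, z) \<in> set_pmf q"
  shows "z \<in> set_pmf p"
  using assms by (force simp: markov_couplings_def)

text \<open>Up to a null set, W \<in> \<open>F\<close> implies (A, B) \<in> \<open>Z\<close>. This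
  turns combinatorial restrictions on rectangles into bounds on the law of W.\<close>

lemma markov_coupling_measure_le:
  assumes q: "q \<in> markov_couplings p"
    and Z: "\<And>w z. w \<in> F \<Longrightarrow> (w, z) \<in> set_pmf q \<Longrightarrow> z \<in> Z"
  shows "measure (map_pmf fst q) F \<le> measure p Z"
proof -
  have p: "p = map_pmf snd q"
    using q by (simp add: markov_couplings_def)
  have "measure q (fst -` F) = measure q (fst -` F \<inter> set_pmf q)"
    by (simp add: measure_Int_set_pmf)
  also have "\<dots> \<le> measure q (snd -` Z)"
    using Z by (intro measure_pmf.finite_measure_mono) auto
  finally show ?thesis
    by (simp add: p)
qed

text \<open>In a fooling set \<open>\<Phi>\<close> no two points lie in a common rectangle of the support, so every value
  of \<open>W\<close> sees at most one of them.\<close>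

lemma markov_coupling_fooling_set:
  assumes q: "q \<in> markov_couplings p"
    and F: "finite F" and \<Phi>: "finite \<Phi>" "\<And>z. z \<in> \<Phi> \<Longrightarrow> c \<le> pmf p z"
    and c: "0 \<le> c"
    and fool: "\<And>a b a' b'. (a, b) \<in> \<Phi> \<Longrightarrow> (a', b') \<in> \<Phi> \<Longrightarrow>
      (a, b') \<in> set_pmf p \<Longrightarrow> (a', b) \<in> set_pmf p \<Longrightarrow> (a, b) = (a', b')"
  shows "measure (map_pmf fst q) F \<le> 1 - (real (card \<Phi>) - real (card F)) * c"
proof -
  \<comment> \<open>The points of \<Phi> seen by some value in \<open>F\<close>. Choosing such a
    value for each is injective, so at least \<open>card \<Phi> - card F\<close> points, each of
    mass at least \<open>c\<close>, are missed by \<open>F\<close>.\<close>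
  let ?H = "{z \<in> \<Phi>. \<exists>w\<in>F. (w, z) \<in> set_pmf q}"
  have "\<forall>z\<in>?H. \<exists>w. w \<in> F \<and> (w, z) \<in> set_pmf q"
    by auto
  from bchoice[OF this] obtain f where f: "\<And>z. z \<in> ?H \<Longrightarrow> f z \<in> F \<and> (f z, z) \<in> set_pmf q"
    by blast
  have "inj_on f ?H"
  proof (rule inj_onI)
    fix z z' assume z: "z \<in> ?H" "z' \<in> ?H" "f z = f z'"
    obtain a b a' b' where ab: "z = (a, b)" "z' = (a', b')"
      by (metis prod.exhaust)
    have "(f z, a, b) \<in> set_pmf q" "(f z, a', b') \<in> set_pmf q"
      using f[OF z(1)] f[OF z(2)] z(3) ab by auto
    then have "(a, b') \<in> set_pmf p" "(a', b) \<in> set_pmf p"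
      by (meson markov_coupling_rectangle[OF q] markov_coupling_support[OF q])+
    then show "z = z'"
      using fool z ab by auto
  qed
  then have "card ?H \<le> card F"
    using f F by (intro card_inj_on_le) auto
  moreover have "card (\<Phi> - ?H) = card \<Phi> - card ?H"
    using \<Phi>(1) by (intro card_Diff_subset) auto
  moreover have "card ?H \<le> card \<Phi>"
    using \<Phi>(1) by (intro card_mono) auto
  ultimately have "real (card \<Phi>) - real (card F) \<le> real (card (\<Phi> - ?H))"
    by simp
  then have "(real (card \<Phi>) - real (card F)) * c \<le> real (card (\<Phi> - ?H)) * c"
    using c by (rule mult_right_mono)
  also have "\<dots> \<le> (\<Sum>z\<in>\<Phi> - ?H. pmf p z)"
    using \<Phi>(2) sum_bounded_below[of "\<Phi> - ?H" c "pmf p"] by auto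
  also have "\<dots> = measure p (\<Phi> - ?H)"
    using \<Phi>(1) by (simp add: measure_measure_pmf_finite)
  finally have "measure p (- (\<Phi> - ?H)) \<le> 1 - (real (card \<Phi>) - real (card F)) * c"
    using measure_pmf.prob_compl[of "\<Phi> - ?H" p] by (simp add: Compl_eq_Diff_UNIV)
  moreover have "measure (map_pmf fst q) F \<le> measure p (- (\<Phi> - ?H))"
    by (rule markov_coupling_measure_le[OF q]) auto
  ultimately show ?thesis
    by linarith
qed

text \<open>Optimality certificate: W = g(A, B) attains the value, and every competing law of W is
  majorized by \<open>t\<close>, hence has no smaller entropy. Attainment makes the
  \<open>LEAST\<close> a true minimum.\<close>

lemma common_entropy_eq:
  fixes g :: "'a \<times> 'b \<Rightarrow> nat" and t :: "nat \<Rightarrow> real"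
  assumes fibre: "\<And>w. (\<exists>a. \<forall>z\<in>set_pmf p. g z = w \<longrightarrow> fst z = a) \<or>
      (\<exists>b. \<forall>z\<in>set_pmf p. g z = w \<longrightarrow> snd z = b)"
    and range: "\<And>z. z \<in> set_pmf p \<Longrightarrow> g z < n"
    and t: "\<And>i. i < n \<Longrightarrow> measure p (g -` {i}) = t i" "\<And>i. i < n \<Longrightarrow> 0 < t i"
    and maj: "\<And>(q :: (nat \<times> 'a \<times> 'b) pmf) F. q \<in> markov_couplings p \<Longrightarrow> finite F \<Longrightarrow>
      card F < n \<Longrightarrow> measure (map_pmf fst q) F \<le> (\<Sum>i<card F. t i)"
  shows "common_entropy p = ennreal (\<Sum>i<n. - (t i * log 2 (t i)))"
  unfolding common_entropy_def
proof (rule Least_equality)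
  let ?q = "map_pmf (\<lambda>z. (g z, z)) p"
  have supp: "set_pmf (map_pmf g p) \<subseteq> {..<n}"
    using range by auto
  have pmf_g: "pmf (map_pmf g p) i = t i" if "i < n" for i
    using t(1)[OF that] by (simp add: pmf_map)
  have t_sum: "(\<Sum>i<n. t i) = 1"
    using sum_pmf_eq_1[OF _ supp] pmf_g by simp
  have "shannon_entropy (map_pmf fst ?q) = ennreal (\<Sum>i<n. - (t i * log 2 (t i)))"
    using shannon_entropy_finite[OF supp] pmf_g by (simp add: map_pmf_comp)
  then show "\<exists>q :: (nat \<times> 'a \<times> 'b) pmf. q \<in> markov_couplings p \<and>
      ennreal (\<Sum>i<n. - (t i * log 2 (t i))) = shannon_entropy (map_pmf fst q)"
    using deterministic_markov_coupling[of p g, OF fibre] by metis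
  have "0 < n"
    using t_sum by (cases n) auto
  fix h assume "\<exists>q :: (nat \<times> 'a \<times> 'b) pmf. q \<in> markov_couplings p \<and>
      h = shannon_entropy (map_pmf fst q)"
  then show "ennreal (\<Sum>i<n. - (t i * log 2 (t i))) \<le> h"
    using shannon_entropy_ge_majorized[OF \<open>0 < n\<close> t(2) t_sum] maj by blast
qed

section \<open>The three-point law, its square, and their common entropies\<close>

lemma pair_pmf_of_set:
  assumes "finite A" "A \<noteq> {}" "finite B" "B \<noteq> {}"
  shows "pair_pmf (pmf_of_set A) (pmf_of_set B) = pmf_of_set (A \<times> B)"
proof (rule pmf_eqI)
  fix z :: "'a \<times> 'b"
  show "pmf (pair_pmf (pmf_of_set A) (pmf_of_set B)) z = pmf (pmf_of_set (A \<times> B)) z"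
    using assms by (cases z) (simp add: pmf_pair card_cartesian_product indicator_times)
qed

definition L_pmf :: "(bool \<times> bool) pmf" where
  "L_pmf = pmf_of_set {(False, False), (False, True), (True, False)}"

lemma set_L_pmf: "set_pmf L_pmf = {(False, False), (False, True), (True, False)}"
  by (simp add: L_pmf_def)

lemma iid_square_L_pmf:
  "iid_square L_pmf = pmf_of_set
    {((False, False), (False, False)), ((False, False), (False, True)),
     ((False, False), (True, False)), ((False, False), (True, True)),
     ((False, True), (False, False)), ((False, True), (True, False)),
     ((True, False), (False, False)), ((True, False), (False, True)),
     ((True, True), (False, False))}" (is "_ = pmf_of_set ?S")
proof -
  let ?f = "\<lambda>((x\<^sub>1 :: bool, y\<^sub>1 :: bool), (x\<^sub>2 :: bool, y\<^sub>2 :: bool)). ((x\<^sub>1, x\<^sub>2), (y\<^sub>1, y\<^sub>2))"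
  let ?P = "{(False, False), (False, True), (True, False)}"
  have "pair_pmf L_pmf L_pmf = pmf_of_set (?P \<times> ?P)"
    unfolding L_pmf_def by (rule pair_pmf_of_set) auto
  moreover have "map_pmf ?f (pmf_of_set (?P \<times> ?P)) = pmf_of_set (?f ` (?P \<times> ?P))"
  proof (rule map_pmf_of_set_inj)
    have "inj ?f"
      by (auto simp: inj_def)
    then show "inj_on ?f (?P \<times> ?P)"
      by (rule inj_on_subset) simp
  qed auto
  moreover have "?f ` (?P \<times> ?P) = ?S"
    by auto
  ultimately show ?thesis
    by (simp add: iid_square_def)
qed

text \<open>W = X is optimal, with law (2/3, 1/3); only the mass of a single value of W needs a
  bound.\<close>

lemma common_entropy_L_pmf: "common_entropy L_pmf = ennreal (log 2 3 - 2/3)"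
proof -
  let ?t = "\<lambda>i. [2/3, 1/3 :: real] ! i"
  have "common_entropy L_pmf = ennreal (\<Sum>i<2. - (?t i * log 2 (?t i)))"
  proof (rule common_entropy_eq[where g = "\<lambda>z. if fst z then 1 else 0"])
    fix w :: nat
    show "(\<exists>a. \<forall>z\<in>set_pmf L_pmf. (if fst z then 1 else 0) = w \<longrightarrow> fst z = a) \<or>
      (\<exists>b. \<forall>z\<in>set_pmf L_pmf. (if fst z then 1 else 0) = w \<longrightarrow> snd z = b)"
      \<comment> \<open>\<open>g\<close> is 1 exactly when X is true, so the row is
        \<open>w = 1\<close>; values above 1 have empty fibres.\<close>
      by (rule disjI1, rule exI[of _ "w = 1"]) auto
  next
    fix i :: nat assume "i < 2"
    then consider "i = 0" | "i = 1" by linarith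
    then have "measure L_pmf ((\<lambda>z. if fst z then 1 else 0) -` {i}) = ?t i \<and> 0 < ?t i"
      by cases (simp_all add: L_pmf_def measure_pmf_of_set Int_insert_left)
    then show "measure L_pmf ((\<lambda>z. if fst z then 1 else 0) -` {i}) = ?t i" "0 < ?t i"
      by auto
  next
    fix q :: "(nat \<times> bool \<times> bool) pmf" and F :: "nat set"
    assume q: "q \<in> markov_couplings L_pmf" and F: "finite F" "card F < 2"
    \<comment> \<open>A rectangle containing both points of this fooling set would contain (True,
      True), which has mass zero.\<close>
    have "measure (map_pmf fst q) F
        \<le> 1 - (real (card {(False, True), (True, False)}) - real (card F)) * (1/3)"
      using q F(1) by (rule markov_coupling_fooling_set)
        (auto simp: L_pmf_def set_L_pmf[unfolded L_pmf_def])
    moreover have "F = {}" if "card F = 0"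
      using that F by simp
    moreover have "card F = 0 \<or> card F = 1"
      using F(2) by linarith
    ultimately show "measure (map_pmf fst q) F \<le> (\<Sum>i<card F. ?t i)"
      by auto
  qed auto
  also have "(\<Sum>i<2. - (?t i * log 2 (?t i))) = log 2 3 - 2/3"
    by (simp add: numeral_2_eq_2 log_divide field_simps)
  finally show ?thesis .
qed

text \<open>Read X and Y as disjoint subsets of {1, 2}. Within a rectangle every X is disjoint from
  every Y, so with S the union of the X that occur, each X lies in S and each Y in its complement.
  There are 2^|S| * 2^(2-|S|) = 4 such pairs, each of mass 1/9. \<open>s\<^sub>1\<close> and
  \<open>s\<^sub>2\<close> encode S.\<close>

lemma rectangle_iid_square_L_pmf:
  assumes q: "q \<in> markov_couplings (iid_square L_pmf)"
  shows "pmf (map_pmf fst q) w \<le> 4/9"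
proof -
  define s\<^sub>1 where "s\<^sub>1 \<longleftrightarrow> (\<exists>a b. (w, a, b) \<in> set_pmf q \<and> fst a)"
  define s\<^sub>2 where "s\<^sub>2 \<longleftrightarrow> (\<exists>a b. (w, a, b) \<in> set_pmf q \<and> snd a)"
  let ?Z = "{(a, b). (fst a \<longrightarrow> s\<^sub>1) \<and> (snd a \<longrightarrow> s\<^sub>2) \<and> (fst b \<longrightarrow> \<not> s\<^sub>1) \<and> (snd b \<longrightarrow> \<not> s\<^sub>2)}"
  have disj: "\<not> (fst a \<and> fst b) \<and> \<not> (snd a \<and> snd b)"
    if "(w, a, b') \<in> set_pmf q" "(w, a', b) \<in> set_pmf q" for a b a' b'
    using markov_coupling_support[OF q markov_coupling_rectangle[OF q that]]
    by (auto simp: iid_square_L_pmf)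
  have "measure (map_pmf fst q) {w} \<le> measure (iid_square L_pmf) ?Z"
  proof (rule markov_coupling_measure_le[OF q])
    fix v z assume "v \<in> {w}" "(v, z) \<in> set_pmf q"
    then obtain a b where z: "z = (a, b)" "(w, a, b) \<in> set_pmf q"
      by (cases z) auto
    then have "fst a \<longrightarrow> s\<^sub>1" "snd a \<longrightarrow> s\<^sub>2" "fst b \<longrightarrow> \<not> s\<^sub>1" "snd b \<longrightarrow> \<not> s\<^sub>2"
      unfolding s\<^sub>1_def s\<^sub>2_def using disj[OF _ z(2)] by blast+
    then show "z \<in> ?Z"
      by (simp add: z(1))
  qed
  also have "\<dots> \<le> 4/9"
    by (cases s\<^sub>1; cases s\<^sub>2)
      (simp_all add: iid_square_L_pmf measure_pmf_of_set Int_insert_left)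
  finally show ?thesis
    by (simp add: measure_pmf_single)
qed

text \<open>Read \<open>X\<close> and \<open>Y\<close> as subsets of \<open>{1, 2}\<close>; the support of the square is the set of disjoint
  pairs. \<open>W\<close> is \<open>0\<close> if \<open>X = {}\<close>, \<open>1\<close> if only \<open>Y = {}\<close>, and isolates each of the two remaining
  points.\<close>

lemma common_entropy_iid_square_L_pmf:
  "common_entropy (iid_square L_pmf) = ennreal (5/3 * log 2 3 - 8/9)"
proof -
  let ?t = "\<lambda>i. [4/9, 3/9, 1/9, 1/9 :: real] ! i"
  let ?g = "\<lambda>(a :: bool \<times> bool, b :: bool \<times> bool). if a = (False, False) then 0
    else if b = (False, False) then 1 else if fst a then 2 else 3 :: nat"
  \<comment> \<open>The pairs of complementary sets. If A is disjoint from the complement of A' and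
    A' from that of A, then A = A', so this set is fooling.\<close>
  let ?\<Phi> = "{((False, False), (True, True)), ((True, True), (False, False)),
    ((True, False), (False, True)), ((False, True), (True, False))}"
  have "common_entropy (iid_square L_pmf) = ennreal (\<Sum>i<4. - (?t i * log 2 (?t i)))"
  proof (rule common_entropy_eq[where g = ?g])
    fix w :: nat
    show "(\<exists>a. \<forall>z\<in>set_pmf (iid_square L_pmf). ?g z = w \<longrightarrow> fst z = a) \<or>
      (\<exists>b. \<forall>z\<in>set_pmf (iid_square L_pmf). ?g z = w \<longrightarrow> snd z = b)"
    proof (cases "w = 1")
      case True
      then show ?thesis
        by (intro disjI2 exI[of _ "(False, False)"]) (auto simp: iid_square_L_pmf)
    next
      case False
      then show ?thesis
        \<comment> \<open>The witness is the empty set for \<open>w = 0\<close>, {1} for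
          \<open>w = 2\<close> and {2} for \<open>w = 3\<close>; X = {1, 2} forces Y = {} and so has
          \<open>g\<close> value 1.\<close>
        by (intro disjI1 exI[of _ "(w = 2, w = 3)"]) (auto simp: iid_square_L_pmf)
    qed
  next
    fix i :: nat assume "i < 4"
    then consider "i = 0" | "i = 1" | "i = 2" | "i = 3" by linarith
    then have "measure (iid_square L_pmf) (?g -` {i}) = ?t i \<and> 0 < ?t i"
      by cases (simp_all add: iid_square_L_pmf measure_pmf_of_set Int_insert_left)
    then show "measure (iid_square L_pmf) (?g -` {i}) = ?t i" "0 < ?t i"
      by auto
  next
    fix q :: "(nat \<times> (bool \<times> bool) \<times> bool \<times> bool) pmf" and F :: "nat set"
    assume q: "q \<in> markov_couplings (iid_square L_pmf)" and F: "finite F" "card F < 4"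
    have fool: "measure (map_pmf fst q) F \<le> 1 - (real (card ?\<Phi>) - real (card F)) * (1/9)"
      using q F(1) by (rule markov_coupling_fooling_set) (auto simp: iid_square_L_pmf)
    consider "card F = 0" | "card F = 1" | "card F = 2" | "card F = 3"
      using F(2) by linarith
    then show "measure (map_pmf fst q) F \<le> (\<Sum>i<card F. ?t i)"
    proof cases
      case 1
      then show ?thesis
        using F(1) by simp
    next
      \<comment> \<open>The fooling set gives only 6/9 for a single value of W; the rectangle bound
        gives the required 4/9.\<close>
      case 2
      then obtain w where "F = {w}"
        by (auto simp: card_1_singleton_iff)
      then show ?thesis
        using rectangle_iid_square_L_pmf[OF q, of w] by (simp add: measure_pmf_single)
    qed (use fool in \<open>simp_all add: numeral_2_eq_2 numeral_3_eq_3\<close>)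
  qed (auto simp: iid_square_L_pmf split: if_splits)
  also have "(\<Sum>i<4. - (?t i * log 2 (?t i))) = 5/3 * log 2 3 - 8/9"
  proof -
    have "log 2 9 = 2 * log 2 (3 :: real)" "log 2 4 = (2 :: real)"
      using log_nat_power[of 3 2 2] log_nat_power[of 2 2 2] by simp_all
    then show ?thesis
      by (simp add: eval_nat_numeral log_divide algebra_simps)
  qed
  finally show ?thesis .
qed

theorem mainTheorem5:
  shows "\<exists>p :: (bool \<times> bool) pmf.
    pmf p (False, False) = 1/3 \<and> pmf p (False, True) = 1/3 \<and>
    pmf p (True, False) = 1/3 \<and> pmf p (True, True) = 0 \<and>
    common_entropy (iid_square p) < 2 * common_entropy p"
proof (intro exI conjI)
  \<comment> \<open>The gap 2 (log 2 3 - 2/3) - (5/3 log 2 3 - 8/9) equals 1/3 log 2 3 - 4/9, which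
    is positive exactly under this bound.\<close>
  have "4/3 < log 2 (3 :: real)"
  proof -
    have "4 = log 2 (2 ^ 4 :: real)"
      by (subst log_nat_power) auto
    also have "\<dots> < log 2 (3 ^ 3)"
      by (subst log_less_cancel_iff) auto
    also have "\<dots> = 3 * log 2 3"
      by (subst log_nat_power) auto
    finally show ?thesis
      by simp
  qed
  then show "common_entropy (iid_square L_pmf) < 2 * common_entropy L_pmf"
    unfolding common_entropy_L_pmf common_entropy_iid_square_L_pmf
    by (subst ennreal_numeral[symmetric], subst ennreal_mult[symmetric])
      (auto intro!: ennreal_lessI)
qed (simp_all add: L_pmf_def)

end
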